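(* Let $f:I\subseteq\mathbb{R}\to\mathbb{R}$ be a differentiable mapping on $I^{\circ}$ such that $f'\in L[a,b]$, where $a,b\in I^{\circ}$ with $a<b$. If $|f'|^{q}$ is a $P$-function on $[a,b]$, $q\geq 1$, then $$\left|\frac16\left[f(a)+4f\left(\frac{a+b}{2}\right)+f(b)\right]-\frac{1}{b-a}\int_{a}^{b}f(x)\,dx\right|\leq\frac{5(b-a)}{36}\left(|f'(b)|^{q}+|f'(a)|^{q}\right)^{\frac1q}.$$
   Context: $I$ is an interval of real numbers and $I^{\circ}$ is its interior. $L[a,b]$ denotes the integrable functions on $[a,b]$. A function $g:J\to\mathbb{R}$ on an interval $J$ is a $P$-function if $g$ is non-negative and $g(tx+(1-t)y)\leq g(x)+g(y)$ for all $x,y\in J$ and $t\in[0,1]$. *)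

theory Defs
  imports "HOL-Analysis.Analysis"
begin

definition P_function_on :: "real set \<Rightarrow> (real \<Rightarrow> real) \<Rightarrow> bool" where
  "P_function_on J g \<longleftrightarrow> is_interval J \<and> (\<forall>x\<in>J. 0 \<le> g x) \<and>
     (\<forall>x\<in>J. \<forall>y\<in>J. \<forall>t\<in>{0..1}. g (t * x + (1 - t) * y) \<le> g x + g y)"

end

theory Submission imports Defs begin

text \<open>
  On an interval \<open>[a, b]\<close> a \<open>P\<close>-function is bounded by the sum of its values at \<open>a\<close> and \<open>b\<close>, since
  every point is a convex combination of the endpoints. Taking \<open>q\<close>-th roots, \<open>f\<close> is Lipschitz on
  \<open>[a, b]\<close> with constant \<open>M = (|f'(b)|^q + |f'(a)|^q)^(1/q)\<close>, and the claim becomes the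
  error bound \<open>5 M (b - a) / 36\<close> of Simpson's rule for Lipschitz functions.

  For that bound, Simpson's weights \<open>1/6, 4/6, 1/6\<close> are read as a Riemann sum: with \<open>h = (b - a) / 6\<close>
  the interval is cut at \<open>a + h\<close>, the midpoint and \<open>b - h\<close>, into pieces of length \<open>h, 2h, 2h, h\<close>,
  and \<open>f\<close> is sampled at \<open>a\<close>, the midpoint (twice) and \<open>b\<close>, always an endpoint of
  its piece. A piece of length \<open>l\<close> contributes an error of at most \<open>M l^2 / 2\<close>, so the total is
  \<open>M (1 + 4 + 4 + 1) h^2 / 2 = 5 M (b - a)^2 / 36\<close>, and Simpson's rule divides by \<open>b - a\<close>.
\<close>

text \<open>
  The error is the integral of \<open>f p - f x\<close>, whose modulus is at most \<open>M\<close> times the distance from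
  \<open>x\<close> to \<open>p\<close>; that distance ranges linearly over \<open>[0, v - u]\<close>.
\<close>
lemma lipschitz_endpoint_rule_error:
  fixes f :: "real \<Rightarrow> real"
  assumes lip: "M-lipschitz_on {u..v} f" and "u \<le> v" and p: "p = u \<or> p = v"
  shows "\<bar>(v - u) * f p - integral {u..v} f\<bar> \<le> M * (v - u)\<^sup>2 / 2"
proof -
  have f_int: "f integrable_on {u..v}"
    by (intro integrable_continuous_interval lipschitz_on_continuous_on[OF lip])
  have diff: "((\<lambda>x. f p - f x) has_integral ((v - u) * f p - integral {u..v} f)) {u..v}"
    using has_integral_diff[OF has_integral_const_real[of "f p" u v] integrable_integral[OF f_int]]
      \<open>u \<le> v\<close> by simp
  have dist: "((\<lambda>x. M * \<bar>p - x\<bar>) has_integral (M * (v - u)\<^sup>2 / 2)) {u..v}"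
  proof -
    \<comment> \<open>As \<open>p\<close> is an endpoint, \<open>x - p\<close> has constant sign, so \<open>|x - p|\<close> has a polynomial primitive.\<close>
    define s :: real where "s = (if p = u then 1 else -1)"
    have "((\<lambda>x. M * (s * (x - p))) has_integral
        (M * s * (v - p)\<^sup>2 / 2 - M * s * (u - p)\<^sup>2 / 2)) {u..v}"
      by (rule fundamental_theorem_of_calculus[OF \<open>u \<le> v\<close>])
        (auto intro!: derivative_eq_intros
          simp flip: has_real_derivative_iff_has_vector_derivative)
    moreover have "M * s * (v - p)\<^sup>2 / 2 - M * s * (u - p)\<^sup>2 / 2 = M * (v - u)\<^sup>2 / 2"
      using p by (auto simp: s_def power2_commute)
    moreover have "M * (s * (x - p)) = M * \<bar>p - x\<bar>" if "x \<in> {u..v}" for x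
      using that p by (auto simp: s_def)
    ultimately show ?thesis
      using has_integral_cong by (smt (verit))
  qed
  have "\<bar>f p - f x\<bar> \<le> M * \<bar>p - x\<bar>" if "x \<in> {u..v}" for x
    using lipschitz_onD[OF lip, of p x] that p \<open>u \<le> v\<close> by (auto simp: dist_real_def)
  then show ?thesis
    using integral_norm_bound_integral[of "\<lambda>x. f p - f x" "{u..v}" "\<lambda>x. M * \<bar>p - x\<bar>"]
      has_integral_integrable[OF diff] has_integral_integrable[OF dist]
    unfolding integral_unique[OF diff] integral_unique[OF dist] by simp
qed

text \<open>
  Each weight of Simpson's rule, times \<open>b - a\<close>, is the total length of the pieces that are sampled
  at its node: \<open>h\<close> at \<open>a\<close> and \<open>b\<close>, \<open>4 h\<close> at the midpoint. The total error is therefore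
  the sum of the errors of the four pieces.
\<close>
theorem simpson_rule_error_lipschitz:
  fixes f :: "real \<Rightarrow> real"
  assumes lip: "M-lipschitz_on {a..b} f" and "a < b"
  shows "\<bar>1 / 6 * (f a + 4 * f ((a + b) / 2) + f b) - 1 / (b - a) * integral {a..b} f\<bar>
    \<le> 5 * (b - a) / 36 * M"
proof -
  define h where "h = (b - a) / 6"
  define m where "m = (a + b) / 2"
  have h: "h > 0" and b: "b = a + 6 * h" and m: "m = a + 3 * h"
    using \<open>a < b\<close> by (auto simp: h_def m_def field_simps)
  have f_int: "f integrable_on {a..b}"
    by (intro integrable_continuous_interval lipschitz_on_continuous_on[OF lip])
  have sub_int: "f integrable_on {u..v}" if "a \<le> u" "v \<le> b" for u v
    using integrable_on_subinterval[OF f_int] that by auto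
  have split: "integral {a..b} f = integral {a..a + h} f + integral {a + h..m} f
      + integral {m..b - h} f + integral {b - h..b} f"
    using Henstock_Kurzweil_Integration.integral_combine[of a "a + h" b f]
      Henstock_Kurzweil_Integration.integral_combine[of "a + h" m b f]
      Henstock_Kurzweil_Integration.integral_combine[of m "b - h" b f]
      sub_int h b m by simp
  have piece: "\<bar>(v - u) * f p - integral {u..v} f\<bar> \<le> M * (v - u)\<^sup>2 / 2"
    if "a \<le> u" "u \<le> v" "v \<le> b" "p = u \<or> p = v" for u v p
    using lipschitz_endpoint_rule_error[OF lipschitz_on_subset[OF lip]] that by auto
  have "\<bar>h * f a - integral {a..a + h} f\<bar> \<le> M * h\<^sup>2 / 2"
    using piece[of a "a + h" a] h b by simp
  moreover have "\<bar>2 * h * f m - integral {a + h..m} f\<bar> \<le> 2 * M * h\<^sup>2"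
    using piece[of "a + h" m m] h b m by (simp add: power_mult_distrib)
  moreover have "\<bar>2 * h * f m - integral {m..b - h} f\<bar> \<le> 2 * M * h\<^sup>2"
    using piece[of m "b - h" m] h b m by (simp add: power_mult_distrib)
  moreover have "\<bar>h * f b - integral {b - h..b} f\<bar> \<le> M * h\<^sup>2 / 2"
    using piece[of "b - h" b b] h b by simp
  ultimately have "\<bar>h * f a + 4 * h * f m + h * f b - integral {a..b} f\<bar> \<le> 5 * M * h\<^sup>2"
    unfolding split abs_le_iff by linarith
  then have "\<bar>h * f a + 4 * h * f m + h * f b - integral {a..b} f\<bar> / (6 * h) \<le> 5 * M * h\<^sup>2 / (6 * h)"
    using h by (intro divide_right_mono) auto
  moreover have "\<bar>h * f a + 4 * h * f m + h * f b - integral {a..b} f\<bar> / (6 * h)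
      = \<bar>(h * f a + 4 * h * f m + h * f b - integral {a..b} f) / (6 * h)\<bar>"
    using h by simp
  moreover have "(h * f a + 4 * h * f m + h * f b - integral {a..b} f) / (6 * h)
      = 1 / 6 * (f a + 4 * f m + f b) - 1 / (b - a) * integral {a..b} f"
    using h b by (simp add: field_simps)
  moreover have "5 * M * h\<^sup>2 / (6 * h) = 5 * (b - a) / 36 * M"
    using h b by (simp add: field_simps power2_eq_square)
  ultimately show ?thesis
    unfolding m_def by metis
qed

lemma P_function_on_le_endpoints:
  assumes "P_function_on {a..b} g" and x: "x \<in> {a..b}"
  shows "g x \<le> g a + g b"
proof -
  have "x \<in> closed_segment b a"
    using x by (auto simp: closed_segment_eq_real_ivl)
  then obtain t where "t \<in> {0..1}" "x = t * a + (1 - t) * b"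
    by (auto simp: in_segment algebra_simps)
  then show ?thesis
    using assms by (auto simp: P_function_on_def)
qed

theorem corollary2:
  fixes f :: "real \<Rightarrow> real" and I :: "real set" and a b q :: real
  assumes "is_interval I"
    and "f differentiable_on interior I"
    and "a \<in> interior I" and "b \<in> interior I" and "a < b"
    and "deriv f absolutely_integrable_on {a..b}"
    and "q \<ge> 1"
    and "P_function_on {a..b} (\<lambda>x. \<bar>deriv f x\<bar> powr q)"
  shows "\<bar>1 / 6 * (f a + 4 * f ((a + b) / 2) + f b) - 1 / (b - a) * integral {a..b} f\<bar>
    \<le> 5 * (b - a) / 36 * (\<bar>deriv f b\<bar> powr q + \<bar>deriv f a\<bar> powr q) powr (1 / q)"
proof -
  define M where "M = (\<bar>deriv f b\<bar> powr q + \<bar>deriv f a\<bar> powr q) powr (1 / q)"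
  have "convex (interior I)"
    using assms(1) by (simp add: is_interval_convex convex_interior)
  then have sub: "{a..b} \<subseteq> interior I"
    using assms(3-5) closed_segment_subset[of a "interior I" b]
    by (simp add: closed_segment_eq_real_ivl)
  have deriv: "(f has_real_derivative deriv f x) (at x within {a..b})" if "x \<in> {a..b}" for x
  proof -
    have "f differentiable at x"
      using assms(2) sub that
      by (auto simp: differentiable_on_eq_differentiable_at)
    then show ?thesis
      by (metis DERIV_deriv_iff_real_differentiable has_field_derivative_at_within)
  qed
  have bound: "\<bar>deriv f x\<bar> \<le> M" if "x \<in> {a..b}" for x
  proof -
    have "(\<bar>deriv f x\<bar> powr q) powr (1 / q) \<le> M"
      unfolding M_def using P_function_on_le_endpoints[OF assms(8) that] assms(7)
      by (intro powr_mono2) auto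
    then show ?thesis
      using assms(7) by (simp add: powr_powr)
  qed
  have "M-lipschitz_on {a..b} f"
  proof (rule lipschitz_onI)
    show "dist (f x) (f y) \<le> M * dist x y" if "x \<in> {a..b}" "y \<in> {a..b}" for x y
      using field_differentiable_bound[of "{a..b}" f "deriv f" M x y] deriv bound that
      by (auto simp: dist_norm norm_minus_commute)
    show "0 \<le> M"
      by (simp add: M_def)
  qed
  from simpson_rule_error_lipschitz[OF this \<open>a < b\<close>] show ?thesis
    unfolding M_def .
qed

end
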